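(* The map $\alpha\mapsto R(\alpha)$ is a bijection from the set $\mathrm{SRW}(\mathbb Z^+)$ of words on which the SR algorithm does not terminate onto the set $\mathrm{STT}$ of all standard tower tableaux (of all shapes), and its inverse is the reading map $T\mapsto\mathrm{Read}(T)$.
   Context: A cell is a pair $(i,j)$ of integers with $i\ge 1$, $j\ge 0$. A tower diagram is a finite set $\mathcal T$ of cells such that $(i,j)\in\mathcal T$ and $0\le k\le j$ imply $(i,k)\in\mathcal T$. The cell $(i,j)$ lies on the diagonal $x+y=i+j$. Flight paths (recursive): a cell $(i,j)\in\mathcal T$ has a flight path in $\mathcal T$ if either (F1) there is no cell $(i',j')\in\mathcal T$ with $i'<i$ and $i'+j'=i+j-1$ (flight path $\{(i,j)\}$), or (F2) such cells exist and, letting $(i',j')$ be the one with largest $i'$, $(i',j')$ has a flight path and $(i',j'+1)\in\mathcal T$ (flight path $\{(i,j),(i',j'+1)\}\cup\mathrm{flightpath}((i',j'),\mathcal T)$). The flight number of such a cell is $a+b$ where $(a,b)$ is the lexicographically smallest element of its flight path. A corner cell of $\mathcal T$ is a cell $(i,j)\in\mathcal T$ with $(i,j+1)\notin\mathcal T$ having a flight path in $\mathcal T$. Sliding: for a positive integer $\alpha$, $\alpha^{\searrow}\mathcal T$ is computed by the procedure $P(\gamma,m)$ started at $\gamma=\alpha$, $m=1$: (S1) if no cell $(i,j)\in\mathcal T$ with $i\ge m$ lies on $x+y=\gamma-1$: (a) if $(\gamma,0)\notin\mathcal T$ the result is $\mathcal T\cup\{(\gamma,0)\}$; (b) if $(\gamma,0)\in\mathcal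 T$, $(\gamma,1)\notin\mathcal T$ the slide terminates (without result); (c) if $(\gamma,0),(\gamma,1)\in\mathcal T$, continue with $P(\gamma+1,\gamma+1)$. (S2) Otherwise let $i\ge m$ be smallest with $(i,\gamma-1-i)\in\mathcal T$: (a) if $(i,\gamma-i)\notin\mathcal T$ the result is $\mathcal T\cup\{(i,\gamma-i)\}$; (b) if $(i,\gamma-i)\in\mathcal T$, $(i,\gamma-i+1)\notin\mathcal T$ the slide terminates; (c) if both are in $\mathcal T$, continue with $P(\gamma+1,i+1)$. A tower tableau of shape $\mathcal T$ ($|\mathcal T|=n$) is a bijection $f:\mathcal T\to\{1,\dots,n\}$; it is standard if for every $a$ the set $\mathcal T_{\le a}=f^{-1}(\{1,\dots,a\})$ is a tower diagram and $f^{-1}(a)$ is a corner cell of $\mathcal T_{\le a}$. The reading word of a standard tower tableau $f$ is $\mathrm{Read}(f)=\alpha_1\cdots\alpha_n$, where $\alpha_k$ is the flight number of $f^{-1}(k)$ in $\mathcal T_{\le k}$. SR algorithm: for a word $\alpha=\alpha_1\cdots\alpha_n$ of positive integers, set $\mathcal T^{(0)}=\varnothing$, $\mathcal T^{(k)}=\alpha_k^{\searrow}\mathcal T^{(k-1)}$; if some slide terminates, the algorithm terminates. Otherwise $\mathcal T^{(k)}=\mathcal T^{(k-1)}\cup\{d_k\}$ and the recording tableau $R(\alpha)$ is the tower tableau of shape $\mathcal T^{(n)}$ labelling $d_k$ by $k$. *)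

theory Defs
  imports Main "HOL-Library.Product_Lexorder"
begin

text \<open>Equations between diagonals such as \<open>x + y = \<gamma> - 1\<close> are written
  \<open>x + y + 1 = \<gamma>\<close>, so that no truncated subtraction on \<^typ>\<open>nat\<close> occurs in them.\<close>

type_synonym cell = "nat \<times> nat"

definition tower_diagram :: "cell set \<Rightarrow> bool" where
  "tower_diagram T \<longleftrightarrow> finite T \<and> (\<forall>i j. (i, j) \<in> T \<longrightarrow> 1 \<le> i)
     \<and> (\<forall>i j k. (i, j) \<in> T \<and> k \<le> j \<longrightarrow> (i, k) \<in> T)"

text \<open>\<open>flight T c P\<close>: the cell \<open>c\<close> has a flight path in \<open>T\<close>, namely \<open>P\<close>.\<close>

inductive flight :: "cell set \<Rightarrow> cell \<Rightarrow> cell set \<Rightarrow> bool" for T :: "cell set" where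
  F1: "(i, j) \<in> T \<Longrightarrow> \<not> (\<exists>i' j'. (i', j') \<in> T \<and> i' < i \<and> i' + j' + 1 = i + j)
    \<Longrightarrow> flight T (i, j) {(i, j)}"
| F2: "(i, j) \<in> T \<Longrightarrow> (i', j') \<in> T \<Longrightarrow> i' < i \<Longrightarrow> i' + j' + 1 = i + j
    \<Longrightarrow> (\<And>p q. (p, q) \<in> T \<Longrightarrow> p < i \<Longrightarrow> p + q + 1 = i + j \<Longrightarrow> p \<le> i')
    \<Longrightarrow> flight T (i', j') P \<Longrightarrow> (i', j' + 1) \<in> T
    \<Longrightarrow> flight T (i, j) ({(i, j), (i', j' + 1)} \<union> P)"

definition has_flight_path :: "cell set \<Rightarrow> cell \<Rightarrow> bool" where
  "has_flight_path T c \<longleftrightarrow> (\<exists>P. flight T c P)"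

definition flight_path :: "cell set \<Rightarrow> cell \<Rightarrow> cell set" where
  "flight_path T c = (THE P. flight T c P)"

text \<open>\<^const>\<open>Min\<close> refers to the lexicographic order on pairs.\<close>

definition flight_number :: "cell set \<Rightarrow> cell \<Rightarrow> nat" where
  "flight_number T c = (case Min (flight_path T c) of (a, b) \<Rightarrow> a + b)"

definition corner_cell :: "cell set \<Rightarrow> cell \<Rightarrow> bool" where
  "corner_cell T c \<longleftrightarrow>
     c \<in> T \<and> (fst c, snd c + 1) \<notin> T \<and> has_flight_path T c"

text \<open>The procedure \<open>P(\<gamma>, m)\<close>. The value \<open>Some d\<close> means that the result is \<open>T \<union> {d}\<close>;
  \<open>None\<close> means that the slide terminates without result. (On a finite \<open>T\<close>, with
  \<open>m \<le> \<gamma>\<close> as in every call arising from a slide, the recursion is well-founded.)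
  In the second case \<open>i + 1 \<le> \<gamma>\<close>, so \<open>\<gamma> - i\<close> is not truncated.\<close>

partial_function (option) slide_from :: "cell set \<Rightarrow> nat \<Rightarrow> nat \<Rightarrow> cell option" where
  "slide_from T \<gamma> m =
    (if \<not> (\<exists>i j. (i, j) \<in> T \<and> m \<le> i \<and> i + j + 1 = \<gamma>) then
       (if (\<gamma>, 0) \<notin> T then Some (\<gamma>, 0)
        else if (\<gamma>, 1) \<notin> T then None
        else slide_from T (\<gamma> + 1) (\<gamma> + 1))
     else
       (let i = (LEAST i. m \<le> i \<and> (\<exists>j. (i, j) \<in> T \<and> i + j + 1 = \<gamma>)) in
        if (i, \<gamma> - i) \<notin> T then Some (i, \<gamma> - i)
        else if (i, \<gamma> - i + 1) \<notin> T then None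
        else slide_from T (\<gamma> + 1) (i + 1)))"

definition slide :: "nat \<Rightarrow> cell set \<Rightarrow> cell option" where
  "slide \<alpha> T = slide_from T \<alpha> 1"

text \<open>A tableau is a partial map on cells; its shape is its domain.\<close>

type_synonym tableau = "cell \<rightharpoonup> nat"

definition tower_tableau :: "tableau \<Rightarrow> bool" where
  "tower_tableau f \<longleftrightarrow> tower_diagram (dom f)
     \<and> bij_betw (\<lambda>c. the (f c)) (dom f) {1..card (dom f)}"

definition cells_upto :: "tableau \<Rightarrow> nat \<Rightarrow> cell set" where
  "cells_upto f a = {c \<in> dom f. the (f c) \<le> a}"

definition cell_labelled :: "tableau \<Rightarrow> nat \<Rightarrow> cell" where
  "cell_labelled f a = (THE c. f c = Some a)"

definition standard_tower_tableau :: "tableau \<Rightarrow> bool" where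
  "standard_tower_tableau f \<longleftrightarrow> tower_tableau f \<and>
     (\<forall>a\<in>{1..card (dom f)}. tower_diagram (cells_upto f a)
        \<and> corner_cell (cells_upto f a) (cell_labelled f a))"

definition STT :: "tableau set" where
  "STT = {f. standard_tower_tableau f}"

definition Read :: "tableau \<Rightarrow> nat list" where
  "Read f = map (\<lambda>k. flight_number (cells_upto f k) (cell_labelled f k))
     [1..<card (dom f) + 1]"

text \<open>Successive slides of a word into \<open>T\<close>; the result is the list \<open>d\<^sub>1, \<dots>, d\<^sub>n\<close> of added cells,
  or \<open>None\<close> as soon as some slide terminates.\<close>

primrec SR_cells :: "cell set \<Rightarrow> nat list \<Rightarrow> cell list option" where
  "SR_cells T [] = Some []"
| "SR_cells T (\<alpha> # w) =
    (case slide \<alpha> T of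
       None \<Rightarrow> None
     | Some d \<Rightarrow> map_option (\<lambda>ds. d # ds) (SR_cells (T \<union> {d}) w))"

definition SRW :: "nat list set" where
  "SRW = {w. (\<forall>\<alpha>\<in>set w. 0 < \<alpha>) \<and> SR_cells {} w \<noteq> None}"

definition recording_tableau :: "nat list \<Rightarrow> tableau" where
  "recording_tableau w = map_of (zip (the (SR_cells {} w)) [1..<length w + 1])"

end

theory Submission imports Defs begin

text \<open>When the slide of \<open>\<alpha>\<close> reaches \<open>P(\<gamma>, m)\<close> with \<open>m > 1\<close>, the cell \<open>(m - 1, \<gamma> - m)\<close> has a
  flight path with flight number \<open>\<alpha>\<close>, and the cell above it lies in \<open>T\<close>. One step of the
  procedure picks the leftmost cell \<open>d\<close> on \<open>x + y = \<gamma>\<close>, in a column \<open>\<ge> m\<close>, that rests on \<open>T\<close> or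
  on the axis, and that choice is exactly the one for which \<open>(m - 1, \<gamma> - m)\<close> is the predecessor
  of \<open>d\<close> in rule (F2). So sliding retraces a flight path in reverse: \<open>slide \<alpha> T = Some d\<close> if
  and only if \<open>d\<close> is a new corner cell of \<open>T \<union> {d}\<close> with flight number \<open>\<alpha>\<close>. The bijection
  follows by comparing the two sides one cell at a time.\<close>

section \<open>Flight paths and flight numbers\<close>

lemma flight_in_diagram: "flight T c P \<Longrightarrow> c \<in> T"
  by (erule flight.cases) auto

text \<open>(F1) and (F2) exclude each other, and maximality of the column in (F2) determines the
  predecessor. This makes the description operator in \<open>flight_path\<close> meaningful.\<close>

lemma flight_unique:
  assumes "flight T c P" "flight T c Q"
  shows "P = Q"
  using assms
proof (induction arbitrary: Q rule: flight.induct)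
  case (F1 i j)
  from F1(3) show ?case
    by cases (use F1(2) in blast)+
next
  case (F2 i j i' j' P)
  from F2.prems show ?case
  proof cases
    case F1
    with F2.hyps show ?thesis by blast
  next
    case (F2 i'' j'' P')
    have "i' = i''"
      using F2 F2.hyps by (meson le_antisym)
    moreover from this have "j' = j''"
      using F2 F2.hyps by linarith
    ultimately show ?thesis
      using F2 F2.IH by auto
  qed
qed

lemma flight_path_eq: "flight T c P \<Longrightarrow> flight_path T c = P"
  unfolding flight_path_def by (rule the_equality) (simp, metis flight_unique)

lemma flight_finite: "flight T c P \<Longrightarrow> finite P"
  by (induction rule: flight.induct) auto

lemma flight_self: "flight T c P \<Longrightarrow> c \<in> P"
  by (erule flight.cases) auto

lemma flight_number_F1:
  assumes "(i, j) \<in> T" "\<not> (\<exists>i' j'. (i', j') \<in> T \<and> i' < i \<and> i' + j' + 1 = i + j)"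
  shows "flight_number T (i, j) = i + j"
  using flight_path_eq[OF flight.F1[OF assms]] by (simp add: flight_number_def)

text \<open>Both cells that (F2) adds are lexicographically above \<open>(i', j')\<close>, which
  already lies in \<open>P\<close>, so the minimum stays that of \<open>P\<close>. Flight numbers
  can thus be followed along the recursion without inspecting paths.\<close>

lemma flight_number_F2:
  assumes "(i, j) \<in> T" "(i', j') \<in> T" "i' < i" "i' + j' + 1 = i + j"
    and "\<And>p q. (p, q) \<in> T \<Longrightarrow> p < i \<Longrightarrow> p + q + 1 = i + j \<Longrightarrow> p \<le> i'"
    and P: "flight T (i', j') P" and "(i', j' + 1) \<in> T"
  shows "flight_number T (i, j) = flight_number T (i', j')"
proof -
  have Q: "flight T (i, j) ({(i, j), (i', j' + 1)} \<union> P)"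
    using assms by (rule flight.F2)
  have fin: "finite P" and self: "(i', j') \<in> P"
    using flight_finite[OF P] flight_self[OF P] by auto
  have "Min P \<le> (i', j')"
    using fin self by simp
  also have "(i', j') \<le> Min {(i, j), (i', j' + 1)}"
    using \<open>i' < i\<close> by (auto simp: min_def)
  finally have "Min ({(i, j), (i', j' + 1)} \<union> P) = Min P"
    using fin self by (subst Min_Un) (auto simp: min_def)
  then show ?thesis
    using flight_path_eq[OF P] flight_path_eq[OF Q] by (simp add: flight_number_def)
qed

lemma flight_number_pos:
  assumes "flight T c P" "\<And>i j. (i, j) \<in> T \<Longrightarrow> 1 \<le> i"
  shows "0 < flight_number T c"
  using assms
proof (induction rule: flight.induct)
  case (F1 i j)
  then have "1 \<le> i" by blast
  with flight_number_F1[OF F1(1,2)] show ?case by simp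
next
  case (F2 i j i' j' P)
  then show ?case
    using flight_number_F2[OF F2.hyps(1-5) F2.hyps(6,7)] by simp
qed

text \<open>The rules inspect only the cell itself and columns to its left. Hence adding a cell
  further to the right leaves path and number unchanged.\<close>

lemma flight_local:
  assumes "flight T c P" "\<And>p q. p \<le> fst c \<Longrightarrow> (p, q) \<in> T \<longleftrightarrow> (p, q) \<in> T'"
  shows "flight T' c P \<and> flight_number T' c = flight_number T c"
  using assms
proof (induction rule: flight.induct)
  case (F1 i j)
  have "(i, j) \<in> T'" "\<not> (\<exists>i' j'. (i', j') \<in> T' \<and> i' < i \<and> i' + j' + 1 = i + j)"
    using F1 by auto
  then show ?case
    using flight.F1[of i j T'] flight_number_F1[of i j T'] flight_number_F1[OF F1(1,2)] by simp
next
  case (F2 i j i' j' P)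
  have IH: "flight T' (i', j') P" "flight_number T' (i', j') = flight_number T (i', j')"
    using F2 by auto
  have *: "(i, j) \<in> T'" "(i', j') \<in> T'" "(i', j' + 1) \<in> T'"
    "\<And>p q. (p, q) \<in> T' \<Longrightarrow> p < i \<Longrightarrow> p + q + 1 = i + j \<Longrightarrow> p \<le> i'"
    using F2 by auto
  show ?case
    using flight.F2[OF *(1,2) F2.hyps(3,4) *(4) IH(1) *(3)]
      flight_number_F2[OF *(1,2) F2.hyps(3,4) *(4) IH(1) *(3)]
      flight_number_F2[OF F2.hyps(1-7)] IH(2) by simp
qed

section \<open>Sliding retraces a flight path\<close>

text \<open>The cell \<open>(i, j)\<close> is the one examined by \<open>P(i + j, m)\<close>; the case \<open>j = 0\<close> is (S1).\<close>

definition landing :: "cell set \<Rightarrow> nat \<Rightarrow> nat \<Rightarrow> nat \<Rightarrow> bool" where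
  "landing T m i j \<longleftrightarrow> m \<le> i \<and> (0 < j \<longrightarrow> (i, j - 1) \<in> T)
     \<and> (\<forall>p q. (p, q) \<in> T \<and> m \<le> p \<and> p < i \<longrightarrow> p + q + 1 \<noteq> i + j)"

text \<open>Once the examined cell is known, (S1) and (S2) have the same three branches, so one
  equation covers both.\<close>

lemma slide_from_landing:
  assumes "landing T m i j"
  shows "slide_from T (i + j) m =
    (if (i, j) \<notin> T then Some (i, j)
     else if (i, j + 1) \<notin> T then None
     else slide_from T (i + j + 1) (i + 1))"
proof (cases "j = 0")
  case True
  \<comment> \<open>For \<open>j = 0\<close>, a cell on the previous diagonal
    \<open>x + y + 1 = i\<close> lies in a column left of \<open>i\<close>, where
    \<open>landing\<close> forbids it.\<close>
  then have "\<not> (\<exists>p q. (p, q) \<in> T \<and> m \<le> p \<and> p + q + 1 = i + j)"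
    using assms by (fastforce simp: landing_def)
  then show ?thesis
    using True by (subst slide_from.simps) simp
next
  case False
  then have ex: "m \<le> i \<and> (\<exists>q. (i, q) \<in> T \<and> i + q + 1 = i + j)"
    using assms by (auto simp: landing_def intro!: exI[of _ "j - 1"])
  have least: "(LEAST p. m \<le> p \<and> (\<exists>q. (p, q) \<in> T \<and> p + q + 1 = i + j)) = i"
    using ex
  proof (rule Least_equality)
    fix p assume "m \<le> p \<and> (\<exists>q. (p, q) \<in> T \<and> p + q + 1 = i + j)"
    then show "i \<le> p"
      using assms unfolding landing_def by (meson not_le)
  qed
  have nonempty: "\<exists>p q. (p, q) \<in> T \<and> m \<le> p \<and> p + q + 1 = i + j"
    using ex by blast
  show ?thesis
    by (subst slide_from.simps) (simp only: nonempty least Let_def, simp)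
qed

lemma landing_exists:
  assumes "m \<le> \<gamma>"
  obtains i j where "\<gamma> = i + j" "landing T m i j"
proof -
  \<comment> \<open>The alternative \<open>p = \<gamma>\<close> stands for the axis in (S1). Cells
    on the previous diagonal lie in columns below \<gamma>, so the least \<open>p\<close> is
    \<gamma> exactly when there are none from column \<open>m\<close> on.\<close>
  define R where "R p \<longleftrightarrow> m \<le> p \<and> (p = \<gamma> \<or> (\<exists>q. (p, q) \<in> T \<and> p + q + 1 = \<gamma>))" for p
  define i where "i = (LEAST p. R p)"
  have "R \<gamma>"
    using assms by (simp add: R_def)
  then have i: "R i" and least: "\<And>p. R p \<Longrightarrow> i \<le> p"
    unfolding i_def by (auto intro: LeastI Least_le)
  have "i \<le> \<gamma>"
    using least \<open>R \<gamma>\<close> .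
  then obtain j where j: "\<gamma> = i + j"
    using le_Suc_ex by blast
  have "landing T m i j"
    unfolding landing_def
  proof (intro conjI allI impI)
    show "m \<le> i"
      using i by (simp add: R_def)
    assume "0 < j"
    then obtain q where "(i, q) \<in> T" "i + q + 1 = i + j"
      using i j by (auto simp: R_def)
    then show "(i, j - 1) \<in> T"
      by auto
  next
    fix p q assume "(p, q) \<in> T \<and> m \<le> p \<and> p < i"
    then show "p + q + 1 \<noteq> i + j"
      using least[of p] j by (auto simp: R_def)
  qed
  with j that show thesis by blast
qed

text \<open>The invariant of the slide of \<alpha>: either the initial call, or a call made just
  after passing through \<open>(p, q)\<close>. Quantifying over \<open>p\<close> and
  \<open>q\<close> avoids the truncated differences \<open>m - 1\<close> and
  \<open>\<gamma> - m\<close>.\<close>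

definition slide_state :: "cell set \<Rightarrow> nat \<Rightarrow> nat \<Rightarrow> nat \<Rightarrow> bool" where
  "slide_state T \<alpha> \<gamma> m \<longleftrightarrow> \<gamma> = \<alpha> \<and> m = 1
     \<or> (\<exists>p q P. m = p + 1 \<and> \<gamma> = p + q + 1 \<and> flight T (p, q) P \<and> (p, q + 1) \<in> T
          \<and> flight_number T (p, q) = \<alpha>)"

text \<open>The initial call gives rule (F1), a later one gives (F2) with predecessor
  \<open>(p, q)\<close>. Inserting \<open>(i, j)\<close> lets the statement serve both for the cell
  finally added and for a cell of \<open>T\<close> that the slide passes.\<close>

lemma landing_flight:
  assumes T: "tower_diagram T" and land: "landing T m i j"
    and state: "slide_state T \<alpha> (i + j) m"
  shows "\<exists>P. flight (insert (i, j) T) (i, j) P \<and> flight_number (insert (i, j) T) (i, j) = \<alpha>"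
  using state unfolding slide_state_def
proof (elim disjE exE conjE)
  let ?T = "insert (i, j) T"
  assume "i + j = \<alpha>" "m = 1"
  moreover from this have "\<not> (\<exists>p q. (p, q) \<in> ?T \<and> p < i \<and> p + q + 1 = i + j)"
    using T land by (fastforce simp: tower_diagram_def landing_def)
  ultimately show ?thesis
    using flight.F1[of i j ?T] flight_number_F1[of i j ?T] by auto
next
  let ?T = "insert (i, j) T"
  fix p q P
  assume *: "m = p + 1" "i + j = p + q + 1" "flight T (p, q) P" "(p, q + 1) \<in> T"
    "flight_number T (p, q) = \<alpha>"
  have "p < i"
    using land * by (simp add: landing_def)
  then have P: "flight ?T (p, q) P" "flight_number ?T (p, q) = \<alpha>"
    using flight_local[OF *(3), of ?T] *(5) by auto
  have pq: "(p, q) \<in> ?T" "(p, q + 1) \<in> ?T" "p + q + 1 = i + j"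
    using flight_in_diagram[OF *(3)] * by auto
  \<comment> \<open>Since \<open>m = p + 1\<close>, \<open>landing\<close> clears all columns
    strictly between \<open>p\<close> and \<open>i\<close>.\<close>
  have max: "r \<le> p" if "(r, s) \<in> ?T" "r < i" "r + s + 1 = i + j" for r s
    using that land *(1) by (force simp: landing_def not_le)
  have ij: "(i, j) \<in> ?T" by simp
  have "flight ?T (i, j) ({(i, j), (p, q + 1)} \<union> P)"
    using max by (rule flight.F2[OF ij pq(1) \<open>p < i\<close> pq(3) _ P(1) pq(2)])
  moreover have "flight_number ?T (i, j) = flight_number ?T (p, q)"
    using max by (rule flight_number_F2[OF ij pq(1) \<open>p < i\<close> pq(3) _ P(1) pq(2)])
  ultimately show ?thesis
    using P(2) by auto
qed

lemma tower_insert_landing: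
  assumes "tower_diagram T" "landing T m i j" "1 \<le> m"
  shows "tower_diagram (insert (i, j) T)"
  unfolding tower_diagram_def
proof (intro conjI allI impI)
  show "finite (insert (i, j) T)"
    using assms by (simp add: tower_diagram_def)
next
  fix p q assume "(p, q) \<in> insert (i, j) T"
  then show "1 \<le> p"
    using assms by (auto simp: tower_diagram_def landing_def)
next
  fix p q k assume *: "(p, q) \<in> insert (i, j) T \<and> k \<le> q"
  show "(p, k) \<in> insert (i, j) T"
  proof (cases "(p, q) = (i, j) \<and> k < j")
    case True
    then have "(i, j - 1) \<in> T" "k \<le> j - 1"
      using assms by (auto simp: landing_def)
    then show ?thesis
      using True assms(1) unfolding tower_diagram_def by blast
  next
    case False
    then show ?thesis
      using * assms(1) unfolding tower_diagram_def by auto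
  qed
qed

lemma slide_from_corner:
  assumes "slide_from T \<gamma> m = Some d" "tower_diagram T" "1 \<le> m" "m \<le> \<gamma>" "slide_state T \<alpha> \<gamma> m"
  shows "d \<notin> T \<and> tower_diagram (insert d T) \<and> corner_cell (insert d T) d
    \<and> flight_number (insert d T) d = \<alpha>"
proof -
  have "finite T"
    using assms(2) by (simp add: tower_diagram_def)
  \<comment> \<open>\<open>N\<close> bounds the occupied diagonals. Continuing requires
    \<open>(i, j + 1)\<close> in \<open>T\<close>, hence \<open>\<gamma> + 1 \<le> N\<close>, so
    \<open>N - \<gamma>\<close> decreases.\<close>
  then obtain N where N: "p + q \<le> N" if "(p, q) \<in> T" for p q
    using finite_nat_set_iff_bounded_le[of "(\<lambda>(p, q). p + q) ` T"] by fastforce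
  from assms show ?thesis
  proof (induction "N - \<gamma>" arbitrary: \<gamma> m rule: less_induct)
    case less
    obtain i j where \<gamma>: "\<gamma> = i + j" and land: "landing T m i j"
      using landing_exists[OF \<open>m \<le> \<gamma>\<close>] .
    note step = slide_from_landing[OF land, folded \<gamma>]
    have state: "slide_state T \<alpha> (i + j) m"
      using less.prems \<gamma> by simp
    obtain P where P: "flight (insert (i, j) T) (i, j) P"
      and num: "flight_number (insert (i, j) T) (i, j) = \<alpha>"
      using landing_flight[OF \<open>tower_diagram T\<close> land state] by blast
    show ?case
    proof (cases "(i, j) \<in> T")
      case False
      then have "d = (i, j)"
        using step less.prems by simp
      \<comment> \<open>By downward closure, a cell above would force \<open>(i, j)\<close> into
        \<open>T\<close>.\<close>
      moreover have "(i, j + 1) \<notin> T"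
        using False \<open>tower_diagram T\<close> unfolding tower_diagram_def by (meson le_add1)
      ultimately show ?thesis
        using False P num tower_insert_landing[OF \<open>tower_diagram T\<close> land \<open>1 \<le> m\<close>]
        by (auto simp: corner_cell_def has_flight_path_def)
    next
      case True
      then have above: "(i, j + 1) \<in> T" and eq: "slide_from T (\<gamma> + 1) (i + 1) = Some d"
        using step less.prems by (auto split: if_splits)
      \<comment> \<open>The flight path just found is therefore one in \<open>T\<close> itself,
        which restores the invariant for the next call.\<close>
      have "insert (i, j) T = T"
        using True by blast
      then have "slide_state T \<alpha> (\<gamma> + 1) (i + 1)"
        using P num above \<gamma> by (auto simp: slide_state_def)
      moreover have "N - (\<gamma> + 1) < N - \<gamma>"
        using N[OF above] \<gamma> by simp
      ultimately show ?thesis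
        using less.hyps[of "\<gamma> + 1" "i + 1"] eq \<open>tower_diagram T\<close> \<gamma> by simp
    qed
  qed
qed

text \<open>Stated with a second set \<open>S\<close> because the slide takes place before the cell \<open>c\<close> is added:
  below, \<open>S\<close> is \<open>T - {c}\<close>.\<close>

lemma flight_slide_from:
  assumes "flight T c P" "tower_diagram T"
    and "\<And>p q. p < fst c \<Longrightarrow> (p, q) \<in> S \<longleftrightarrow> (p, q) \<in> T"
    and "0 < snd c \<Longrightarrow> (fst c, snd c - 1) \<in> S"
  shows "\<exists>m. landing S m (fst c) (snd c)
    \<and> slide (flight_number T c) S = slide_from S (fst c + snd c) m"
  using assms
proof (induction rule: flight.induct)
  case (F1 i j)
  have "1 \<le> i"
    using F1 by (auto simp: tower_diagram_def)
  then have "landing S 1 i j"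
    using F1 by (auto simp: landing_def)
  then show ?case
    using flight_number_F1[OF F1(1,2)] by (auto simp: slide_def)
next
  case (F2 i j i' j' P)
  have agree: "(p, q) \<in> S \<longleftrightarrow> (p, q) \<in> T" if "p < i" for p q
    using F2.prems that by simp
  \<comment> \<open>As \<open>i' < i\<close>, this cell also lies in \<open>S\<close>, which is the
    support condition of the induction hypothesis.\<close>
  have down: "(i', j' - 1) \<in> T"
    using F2.prems(1) F2.hyps(2) unfolding tower_diagram_def by (meson diff_le_self)
  obtain m where m: "landing S m i' j'"
    "slide (flight_number T (i', j')) S = slide_from S (i' + j') m"
    using F2.IH F2.prems(1) agree down F2.hyps(3) by auto
  \<comment> \<open>Both \<open>(i', j')\<close> and \<open>(i', j' + 1)\<close> lie in
    \<open>S\<close>, so the step at \<open>(i', j')\<close> continues, and it does so on the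
    diagonal of \<open>(i, j)\<close>.\<close>
  have "slide (flight_number T (i, j)) S = slide_from S (i + j) (i' + 1)"
    using flight_number_F2[OF F2.hyps(1-7)] slide_from_landing[OF m(1)] m(2) F2.hyps agree
    by simp
  moreover have "landing S (i' + 1) i j"
    using F2.hyps(3,5) F2.prems(3) agree by (fastforce simp: landing_def)
  ultimately show ?case by auto
qed

text \<open>One half of the correspondence for a single cell; \<open>corner_slide\<close> is the
  converse. Positivity of \<alpha> provides \<open>m \<le> \<gamma>\<close> for the initial
  call.\<close>

lemma slide_corner:
  assumes "tower_diagram T" "0 < \<alpha>" "slide \<alpha> T = Some d"
  shows "d \<notin> T" "tower_diagram (insert d T)" "corner_cell (insert d T) d"
    "flight_number (insert d T) d = \<alpha>"
  using slide_from_corner[of T \<alpha> 1 d \<alpha>] assms by (auto simp: slide_def slide_state_def)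

text \<open>\<open>S\<close> differs from \<open>insert d S\<close> only at \<open>d\<close>, so the
  slide follows the flight path up to the step that examines \<open>d\<close>. There it stops with
  \<open>d\<close>, because \<open>d\<close> is not yet in \<open>S\<close>.\<close>

lemma corner_slide:
  assumes T: "tower_diagram (insert d S)" and "d \<notin> S" and corner: "corner_cell (insert d S) d"
  shows "0 < flight_number (insert d S) d" "slide (flight_number (insert d S) d) S = Some d"
proof -
  let ?T = "insert d S"
  obtain i j where d: "d = (i, j)"
    by (cases d)
  obtain P where P: "flight ?T d P"
    using corner by (auto simp: corner_cell_def has_flight_path_def)
  show "0 < flight_number ?T d"
    using flight_number_pos[OF P] T by (auto simp: tower_diagram_def)
  have "(i, j - 1) \<in> S" if "0 < j"
  proof -
    have "(i, j) \<in> ?T" "j - 1 \<le> j"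
      using d by auto
    then have "(i, j - 1) \<in> ?T"
      using T unfolding tower_diagram_def by blast
    then show ?thesis
      using d that by auto
  qed
  then obtain m where m: "landing S m i j" "slide (flight_number ?T d) S = slide_from S (i + j) m"
    using flight_slide_from[OF P T, of S] d by auto
  show "slide (flight_number ?T d) S = Some d"
    using slide_from_landing[OF m(1)] m(2) \<open>d \<notin> S\<close> d by simp
qed

section \<open>Tableaux as sequences of cells\<close>

text \<open>Turns the recursion into one condition per index, with the prefix sets as intermediate
  diagrams.\<close>

lemma SR_cells_eq_Some_iff:
  "SR_cells T w = Some ds \<longleftrightarrow> length ds = length w
     \<and> (\<forall>k<length w. slide (w ! k) (T \<union> set (take k ds)) = Some (ds ! k))"
proof (induction w arbitrary: T ds)
  case Nil
  then show ?case by auto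
next
  case (Cons \<alpha> w)
  show ?case
  proof (cases ds)
    case Nil
    then show ?thesis by (auto split: option.splits)
  next
    case (Cons d es)
    have "SR_cells T (\<alpha> # w) = Some ds \<longleftrightarrow>
        slide \<alpha> T = Some d \<and> SR_cells (T \<union> {d}) w = Some es"
      using Cons by (auto split: option.splits)
    also have "\<dots> \<longleftrightarrow> length ds = length (\<alpha> # w)
        \<and> (\<forall>k<length (\<alpha> # w). slide ((\<alpha> # w) ! k) (T \<union> set (take k ds)) = Some (ds ! k))"
      by (auto simp: Cons.IH Cons All_less_Suc2)
    finally show ?thesis .
  qed
qed

definition label_cells :: "cell list \<Rightarrow> tableau" where
  "label_cells ds = map_of (zip ds [1..<length ds + 1])"

text \<open>Standard tower tableaux in list form, the meeting point of words and tableaux. The set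
  of the first \<open>k\<close> entries plays the role of the cells with label at most
  \<open>k\<close>.\<close>

definition corner_sequence :: "cell list \<Rightarrow> bool" where
  "corner_sequence ds \<longleftrightarrow> distinct ds \<and> (\<forall>k<length ds.
     tower_diagram (set (take (Suc k) ds)) \<and> corner_cell (set (take (Suc k) ds)) (ds ! k))"

lemma label_cells_eq_Some_iff:
  assumes "distinct ds"
  shows "label_cells ds c = Some a \<longleftrightarrow> (\<exists>k<length ds. c = ds ! k \<and> a = Suc k)"
  unfolding label_cells_def using assms
  by (subst map_of_eq_Some_iff) (auto simp: in_set_zip simp del: upt_Suc)

lemma dom_label_cells: "dom (label_cells ds) = set ds"
  unfolding label_cells_def by (simp add: dom_map_of_zip del: upt_Suc)

lemma cells_upto_label_cells:
  assumes "distinct ds" "k \<le> length ds"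
  shows "cells_upto (label_cells ds) k = set (take k ds)"
proof -
  have "c \<in> cells_upto (label_cells ds) k \<longleftrightarrow> (\<exists>a. label_cells ds c = Some a \<and> a \<le> k)" for c
    by (auto simp: cells_upto_def)
  moreover have "(\<exists>a. label_cells ds c = Some a \<and> a \<le> k) \<longleftrightarrow> (\<exists>l<k. c = ds ! l)" for c
    unfolding label_cells_eq_Some_iff[OF assms(1)]
    using assms(2) by (metis Suc_leI Suc_le_lessD less_le_trans)
  ultimately have "cells_upto (label_cells ds) k = (!) ds ` {0..<k}"
    by (simp add: set_eq_iff image_iff Bex_def)
  then show ?thesis
    by (simp only: nth_image[OF assms(2)])
qed

lemma cell_labelled_label_cells:
  assumes "distinct ds" "k < length ds"
  shows "cell_labelled (label_cells ds) (Suc k) = ds ! k"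
  unfolding cell_labelled_def label_cells_eq_Some_iff[OF assms(1)] using assms(2) by auto

lemma Read_label_cells:
  assumes "distinct ds"
  shows "Read (label_cells ds) =
    map (\<lambda>k. flight_number (set (take (Suc k) ds)) (ds ! k)) [0..<length ds]"
  using assms
  by (auto intro!: nth_equalityI simp: Read_def dom_label_cells distinct_card
      cells_upto_label_cells cell_labelled_label_cells simp del: upt_Suc)

lemma label_cells_standard:
  assumes "corner_sequence ds"
  shows "standard_tower_tableau (label_cells ds)"
proof -
  have distinct: "distinct ds"
    using assms by (simp add: corner_sequence_def)
  note labels = label_cells_eq_Some_iff[OF distinct]
  \<comment> \<open>The empty list is separate because \<open>corner_sequence\<close> constrains
    only nonempty prefixes.\<close>
  have tower: "tower_diagram (set ds)"
  proof (cases "ds = []")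
    case True
    then show ?thesis by (simp add: tower_diagram_def)
  next
    case False
    then have "length ds - 1 < length ds" "take (Suc (length ds - 1)) ds = ds"
      by auto
    then show ?thesis
      using assms unfolding corner_sequence_def by metis
  qed
  have label: "the (label_cells ds (ds ! k)) = Suc k" if "k < length ds" for k
    using labels[of "ds ! k" "Suc k"] that by auto
  have "bij_betw (\<lambda>c. the (label_cells ds c)) (set ds) {1..length ds}"
    unfolding bij_betw_def
  proof
    show "inj_on (\<lambda>c. the (label_cells ds c)) (set ds)"
      by (rule inj_onI) (metis in_set_conv_nth label nat.inject)
    have "(\<lambda>c. the (label_cells ds c)) ` set ds = Suc ` {..<length ds}"
      using label by (force simp: in_set_conv_nth image_iff)
    then show "(\<lambda>c. the (label_cells ds c)) ` set ds = {1..length ds}"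
      by (simp add: lessThan_atLeast0 image_Suc_atLeastLessThan atLeastLessThanSuc_atLeastAtMost)
  qed
  moreover have "tower_diagram (cells_upto (label_cells ds) a)
      \<and> corner_cell (cells_upto (label_cells ds) a) (cell_labelled (label_cells ds) a)"
    if a: "a \<in> {1..length ds}" for a
  proof -
    obtain k where "a = Suc k" "k < length ds"
      using a by (cases a) auto
    then show ?thesis
      using assms distinct
      by (simp add: corner_sequence_def cells_upto_label_cells cell_labelled_label_cells)
  qed
  ultimately show ?thesis
    using tower distinct
    by (simp add: standard_tower_tableau_def tower_tableau_def dom_label_cells distinct_card)
qed

lemma standard_label_cells:
  assumes "standard_tower_tableau f"
  obtains ds where "f = label_cells ds" "corner_sequence ds"
proof -
  define n where "n = card (dom f)"
  \<comment> \<open>The cells in the order of their labels; labels start at 1, list indices at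
    0.\<close>
  define ds where "ds = map (\<lambda>k. cell_labelled f (Suc k)) [0..<n]"
  have bij: "bij_betw (\<lambda>c. the (f c)) (dom f) {1..n}"
    using assms by (simp add: standard_tower_tableau_def tower_tableau_def n_def)
  have unique: "c = c'" if "f c = Some a" "f c' = Some a" for c c' a
    using bij_betw_imp_inj_on[OF bij] that by (metis domI inj_onD option.sel)
  have labelled: "f (cell_labelled f a) = Some a" if "a \<in> {1..n}" for a
  proof -
    have "a \<in> (\<lambda>c. the (f c)) ` dom f"
      using that bij by (simp add: bij_betw_def)
    then obtain c where "f c = Some a"
      by auto
    then show ?thesis
      unfolding cell_labelled_def by (rule theI) (metis unique \<open>f c = Some a\<close>)
  qed
  have range: "a \<in> {1..n}" if "f c = Some a" for c a
    using bij_betwE[OF bij] that by (metis domI option.sel)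
  have len: "length ds = n"
    by (simp add: ds_def)
  have nth: "f (ds ! k) = Some (Suc k)" if "k < n" for k
    using labelled[of "Suc k"] that by (simp add: ds_def)
  have distinct: "distinct ds"
    unfolding distinct_conv_nth len by (metis nth nat.inject option.inject)
  have "f c = Some a \<longleftrightarrow> label_cells ds c = Some a" for c a
  proof -
    have "f c = Some a \<longleftrightarrow> (\<exists>k<n. c = ds ! k \<and> a = Suc k)"
    proof
      assume c: "f c = Some a"
      then obtain k where "a = Suc k" "k < n"
        using range[OF c] by (cases a) auto
      then show "\<exists>k<n. c = ds ! k \<and> a = Suc k"
        using unique c nth by blast
    qed (auto simp: nth)
    then show ?thesis
      using label_cells_eq_Some_iff[OF distinct] len by simp
  qed
  then have f: "f = label_cells ds"
    by (metis not_Some_eq ext)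
  have "corner_sequence ds"
    unfolding corner_sequence_def
  proof (intro conjI allI impI distinct)
    fix k assume k: "k < length ds"
    then have "Suc k \<in> {1..card (dom f)}"
      using len by (simp add: n_def)
    then have "tower_diagram (cells_upto f (Suc k))
        \<and> corner_cell (cells_upto f (Suc k)) (cell_labelled f (Suc k))"
      using assms unfolding standard_tower_tableau_def by blast
    then show "tower_diagram (set (take (Suc k) ds))"
      "corner_cell (set (take (Suc k) ds)) (ds ! k)"
      using k distinct by (simp_all add: f cells_upto_label_cells cell_labelled_label_cells)
  qed
  with f that show thesis by blast
qed

text \<open>\<open>slide_corner\<close> applied at each prefix: every added cell is a new corner
  whose flight number is the letter just slid, so the cells determine the word.\<close>

lemma SR_cells_corner_sequence:
  assumes "SR_cells {} w = Some ds" "\<forall>\<alpha>\<in>set w. 0 < \<alpha>"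
  shows "corner_sequence ds"
    "w = map (\<lambda>k. flight_number (set (take (Suc k) ds)) (ds ! k)) [0..<length ds]"
proof -
  have len: "length ds = length w"
    and slides: "\<And>k. k < length w \<Longrightarrow> slide (w ! k) (set (take k ds)) = Some (ds ! k)"
    using assms(1) by (auto simp: SR_cells_eq_Some_iff)
  have step: "set (take (Suc k) ds) = insert (ds ! k) (set (take k ds))" if "k < length ds" for k
    using that by (simp add: take_Suc_conv_app_nth)
  have tower: "tower_diagram (set (take k ds))" if "k \<le> length ds" for k
    using that
  proof (induction k)
    case 0
    then show ?case by (simp add: tower_diagram_def)
  next
    case (Suc k)
    then show ?case
      using slide_corner(2)[OF _ _ slides, of k] assms(2) len step by simp
  qed
  have corner: "ds ! k \<notin> set (take k ds)" "corner_cell (set (take (Suc k) ds)) (ds ! k)"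
    "flight_number (set (take (Suc k) ds)) (ds ! k) = w ! k" if "k < length ds" for k
    using slide_corner[OF tower _ slides, of k] assms(2) len step that by simp_all
  \<comment> \<open>\<open>ds ! l\<close> avoids its own prefix, which contains
    \<open>ds ! k\<close>.\<close>
  have "ds ! k \<noteq> ds ! l" if "k < l" "l < length ds" for k l
    using corner(1)[OF that(2)] that by (force simp: in_set_conv_nth)
  then have "distinct ds"
    unfolding distinct_conv_nth by (metis linorder_neqE_nat)
  then show "corner_sequence ds"
    using corner tower by (simp add: corner_sequence_def Suc_leI)
  show "w = map (\<lambda>k. flight_number (set (take (Suc k) ds)) (ds ! k)) [0..<length ds]"
    using corner len by (intro nth_equalityI) simp_all
qed

text \<open>The converse, by \<open>corner_slide\<close> at each prefix. Distinctness of
  \<open>ds\<close> ensures that each cell is new when its slide takes place.\<close>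

lemma corner_sequence_SR_cells:
  assumes "corner_sequence ds"
    and w: "w = map (\<lambda>k. flight_number (set (take (Suc k) ds)) (ds ! k)) [0..<length ds]"
  shows "SR_cells {} w = Some ds" "\<forall>\<alpha>\<in>set w. 0 < \<alpha>"
proof -
  have *: "0 < flight_number (set (take (Suc k) ds)) (ds ! k)
      \<and> slide (flight_number (set (take (Suc k) ds)) (ds ! k)) (set (take k ds)) = Some (ds ! k)"
    if k: "k < length ds" for k
  proof -
    have "distinct (take (Suc k) ds)"
      using assms(1) by (simp add: corner_sequence_def)
    then have new: "ds ! k \<notin> set (take k ds)"
      using k by (simp add: take_Suc_conv_app_nth)
    have step: "set (take (Suc k) ds) = insert (ds ! k) (set (take k ds))"
      using k by (simp add: take_Suc_conv_app_nth)
    show ?thesis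
      using corner_slide[OF _ new] assms(1) k by (simp add: corner_sequence_def flip: step)
  qed
  show "SR_cells {} w = Some ds"
    using * by (simp add: SR_cells_eq_Some_iff w)
  show "\<forall>\<alpha>\<in>set w. 0 < \<alpha>"
    using * by (auto simp: w)
qed

lemma recording_tableau_eq:
  assumes "SR_cells {} w = Some ds"
  shows "recording_tableau w = label_cells ds"
  using assms SR_cells_eq_Some_iff[of "{}" w ds]
  by (simp add: recording_tableau_def label_cells_def)

theorem theorem3p10:
  shows "bij_betw recording_tableau SRW STT
    \<and> (\<forall>w\<in>SRW. Read (recording_tableau w) = w)
    \<and> (\<forall>f\<in>STT. Read f \<in> SRW \<and> recording_tableau (Read f) = f)"
proof -
  have word: "recording_tableau w \<in> STT \<and> Read (recording_tableau w) = w" if w: "w \<in> SRW" for w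
  proof -
    obtain ds where ds: "SR_cells {} w = Some ds" and pos: "\<forall>\<alpha>\<in>set w. 0 < \<alpha>"
      using w by (auto simp: SRW_def)
    note seq = SR_cells_corner_sequence[OF ds pos]
    have "Read (label_cells ds) = w"
      using seq(1) Read_label_cells[of ds] by (simp add: corner_sequence_def flip: seq(2))
    then show ?thesis
      using label_cells_standard[OF seq(1)] by (simp add: recording_tableau_eq[OF ds] STT_def)
  qed
  have tableau: "Read f \<in> SRW \<and> recording_tableau (Read f) = f" if STT: "f \<in> STT" for f
  proof -
    obtain ds where f: "f = label_cells ds" and seq: "corner_sequence ds"
      using STT standard_label_cells[of f] unfolding STT_def by blast
    have "Read f = map (\<lambda>k. flight_number (set (take (Suc k) ds)) (ds ! k)) [0..<length ds]"
      using seq by (simp add: f Read_label_cells corner_sequence_def)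
    note cells = corner_sequence_SR_cells[OF seq this]
    then show ?thesis
      using recording_tableau_eq[OF cells(1)] by (simp add: SRW_def f)
  qed
  have "bij_betw recording_tableau SRW STT"
    using word tableau by (intro bij_betw_byWitness[where f' = Read]) auto
  with word tableau show ?thesis by blast
qed

end
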